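(* Let $d \ge 1$ be an integer and let $(t_k)_{k\in\mathbb{N}} \subset \mathbb{R}^d$ be a sequence such that $(h_k)_{k\in\mathbb{N}} := \big(\frac{1}{(2\pi)^{d/2}} e^{i\langle \cdot, t_k\rangle}\big)_{k\in\mathbb{N}}$ is a frame for $L_2([-\pi,\pi]^d)$ with frame bounds $A^2$ and $B^2$ (where $0 < A \le B$). If $(\tau_k)_{k\in\mathbb{N}} \subset \mathbb{R}^d$ is a sequence such that $$\sup_{k\in\mathbb{N}} \|\tau_k - t_k\|_\infty < \frac{1}{\pi d}\ln\Big(1+\frac{A}{B}\Big),$$ then the sequence $(f_k)_{k\in\mathbb{N}} := \big(\frac{1}{(2\pi)^{d/2}} e^{i\langle \cdot, \tau_k\rangle}\big)_{k\in\mathbb{N}}$ is also a frame for $L_2([-\pi,\pi]^d)$.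
   Context: A frame for a separable Hilbert space $H$ is a sequence $(f_n)_n \subset H$ such that for some $0 < A \le B$, $$A^2\|f\|^2 \le \sum_n |\langle f, f_n\rangle|^2 \le B^2 \|f\|^2 \quad \text{for all } f \in H.$$ The best (largest) $A^2$ and best (smallest) $B^2$ for which these inequalities hold are called the frame bounds of the frame. Here $L_2([-\pi,\pi]^d)$ is the complex Hilbert space with Lebesgue measure, $e^{i\langle\cdot,t\rangle}$ denotes the function $x \mapsto e^{i\langle x,t\rangle}$ on $[-\pi,\pi]^d$, with $\langle x,t\rangle$ the Euclidean inner product on $\mathbb{R}^d$, and $\|\cdot\|_\infty$ is the maximum norm on $\mathbb{R}^d$. *)

theory Defs
  imports "HOL-Analysis.Analysis"
begin

text \<open>
  Elements of the complex space \<open>L\<^sub>2(M)\<close> are represented by square-integrable functions rather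
  than by their classes modulo equality almost everywhere. The inner product, the norm and the
  frame inequalities below depend only on these classes.
\<close>

definition L2_space :: "'a measure \<Rightarrow> ('a \<Rightarrow> complex) set" where
  "L2_space M = {f \<in> borel_measurable M. integrable M (\<lambda>x. (cmod (f x))\<^sup>2)}"

definition L2_inner :: "'a measure \<Rightarrow> ('a \<Rightarrow> complex) \<Rightarrow> ('a \<Rightarrow> complex) \<Rightarrow> complex" where
  "L2_inner M f g = (LINT x|M. f x * cnj (g x))"

definition L2_norm :: "'a measure \<Rightarrow> ('a \<Rightarrow> complex) \<Rightarrow> real" where
  "L2_norm M f = sqrt (LINT x|M. (cmod (f x))\<^sup>2)"

text \<open>
  Summability is required explicitly because \<open>suminf\<close> is unspecified for divergent real series.
\<close>

definition frame_ineq :: "'a measure \<Rightarrow> (nat \<Rightarrow> 'a \<Rightarrow> complex) \<Rightarrow> real \<Rightarrow> real \<Rightarrow> bool" where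
  "frame_ineq M h a b \<longleftrightarrow>
     (\<forall>f \<in> L2_space M.
        summable (\<lambda>n. (cmod (L2_inner M f (h n)))\<^sup>2) \<and>
        a * (L2_norm M f)\<^sup>2 \<le> (\<Sum>n. (cmod (L2_inner M f (h n)))\<^sup>2) \<and>
        (\<Sum>n. (cmod (L2_inner M f (h n)))\<^sup>2) \<le> b * (L2_norm M f)\<^sup>2)"

definition L2_frame :: "'a measure \<Rightarrow> (nat \<Rightarrow> 'a \<Rightarrow> complex) \<Rightarrow> bool" where
  "L2_frame M h \<longleftrightarrow>
     (\<forall>n. h n \<in> L2_space M) \<and>
     (\<exists>A B. 0 < A \<and> A \<le> B \<and> frame_ineq M h (A\<^sup>2) (B\<^sup>2))"

text \<open>
  The frame bounds are the optimal constants, and \<open>a\<close>, \<open>b\<close> play the role of \<open>A\<^sup>2\<close>, \<open>B\<^sup>2\<close>.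
  The lower and the upper inequality do not involve each other's constant, so joint optimality
  over pairs is the same as optimality of each constant separately.
\<close>

definition L2_frame_bounds ::
    "'a measure \<Rightarrow> (nat \<Rightarrow> 'a \<Rightarrow> complex) \<Rightarrow> real \<Rightarrow> real \<Rightarrow> bool" where
  "L2_frame_bounds M h a b \<longleftrightarrow>
     frame_ineq M h a b \<and> (\<forall>a' b'. frame_ineq M h a' b' \<longrightarrow> a' \<le> a \<and> b \<le> b')"

definition cube_measure :: "(real ^ 'd) measure" where
  "cube_measure = lebesgue_on (cbox (\<chi> i. - pi) (\<chi> i. pi))"

definition expo :: "real ^ 'd \<Rightarrow> real ^ 'd \<Rightarrow> complex" where
  "expo t x = 1 / complex_of_real ((2 * pi) powr (real CARD('d) / 2)) *
              exp (\<i> * complex_of_real (x \<bullet> t))"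

end

theory Submission
  imports Defs
begin

text \<open>
  The exponentials \<open>h\<^sub>k\<close> and \<open>f\<^sub>k\<close> differ by a factor that is the exponential of the linear form
  \<open>\<langle>x, \<tau>\<^sub>k - t\<^sub>k\<rangle>\<close>. Expanding this factor into its power series turns \<open>\<langle>g, f\<^sub>k\<rangle> - \<langle>g, h\<^sub>k\<rangle>\<close> into
  \<open>\<Sum>n\<ge>1. (1 / n!) \<langle>p\<^sub>k\<^sup>n g, h\<^sub>k\<rangle>\<close>, where \<open>p\<^sub>k = -i \<langle>x, \<tau>\<^sub>k - t\<^sub>k\<rangle>\<close>. The multiplier \<open>p\<^sub>k\<close> depends on
  \<open>k\<close>, so that the upper frame inequality does not apply to \<open>p\<^sub>k\<^sup>n g\<close> as it stands. But \<open>p\<^sub>k\<close> is a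
  sum of \<open>d\<close> products of a coefficient depending on \<open>k\<close> only, of modulus at most
  \<open>\<delta> = sup \<parallel>\<tau>\<^sub>k - t\<^sub>k\<parallel>\<close>, with a coordinate function depending on \<open>x\<close> only, of modulus at most \<open>\<pi>\<close> on the
  cube. The coefficients leave the inner product, the coordinate functions are absorbed into
  \<open>g\<close>, and Minkowski's inequality in \<open>\<ell>\<^sub>2\<close> bounds the \<open>n\<close>-th term by
  \<open>(\<pi> d \<delta>)\<^sup>n / n! \<cdot> B \<parallel>g\<parallel>\<close> (lemma \<open>Bessel_power_multiplier\<close>).

  Summation over \<open>n \<ge> 1\<close> gives \<open>\<parallel>(\<langle>g, f\<^sub>k\<rangle> - \<langle>g, h\<^sub>k\<rangle>)\<^sub>k\<parallel> \<le> B (e\<^bsup>\<pi> d \<delta>\<^esup> - 1) \<parallel>g\<parallel>\<close> (lemma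
  \<open>Bessel_exp_multiplier\<close>). The hypothesis on \<open>\<delta>\<close> says exactly that the constant on the right is
  smaller than \<open>A\<close>, and the triangle inequality in \<open>\<ell>\<^sub>2\<close> then yields both frame
  inequalities for \<open>(f\<^sub>k)\<close> (lemma \<open>frame_perturbation\<close>). All \<open>\<ell>\<^sub>2\<close> estimates are made over the
  indices below an arbitrary \<open>K\<close>, with constants independent of \<open>K\<close>.
\<close>

section \<open>Square-integrable functions\<close>

lemma L2_norm_nonneg: "0 \<le> L2_norm M f"
  by (simp add: L2_norm_def)

lemma integrable_L2_inner:
  assumes "f \<in> L2_space M" "g \<in> L2_space M"
  shows "integrable M (\<lambda>x. f x * cnj (g x))"
proof (rule Bochner_Integration.integrable_bound)
  show "integrable M (\<lambda>x. (cmod (f x))\<^sup>2 + (cmod (g x))\<^sup>2)"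
    using assms by (simp add: L2_space_def)
  have [measurable]: "f \<in> borel_measurable M" "g \<in> borel_measurable M"
    using assms by (auto simp: L2_space_def)
  have [measurable]: "cnj \<in> borel_measurable borel"
    by (intro borel_measurable_continuous_onI continuous_intros)
  show "(\<lambda>x. f x * cnj (g x)) \<in> borel_measurable M"
    by measurable
  have "cmod (f x) * cmod (g x) \<le> (cmod (f x))\<^sup>2 + (cmod (g x))\<^sup>2" for x
  proof -
    have "2 * cmod (f x) * cmod (g x) \<le> (cmod (f x))\<^sup>2 + (cmod (g x))\<^sup>2"
      by (rule sum_squares_bound)
    moreover have "0 \<le> cmod (f x) * cmod (g x)" by simp
    ultimately show ?thesis by linarith
  qed
  then show "AE x in M. norm (f x * cnj (g x)) \<le> norm ((cmod (f x))\<^sup>2 + (cmod (g x))\<^sup>2)"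
    by (simp add: norm_mult)
qed

lemma L2_bounded_multiplier:
  assumes f: "f \<in> L2_space M" and u: "u \<in> borel_measurable M"
    and c: "0 \<le> c" "\<And>x. x \<in> space M \<Longrightarrow> cmod (u x) \<le> c"
  shows "(\<lambda>x. u x * f x) \<in> L2_space M"
    and "L2_norm M (\<lambda>x. u x * f x) \<le> c * L2_norm M f"
proof -
  have fm [measurable]: "f \<in> borel_measurable M" and um [measurable]: "u \<in> borel_measurable M"
    and fi: "integrable M (\<lambda>x. (cmod (f x))\<^sup>2)"
    using f u by (auto simp: L2_space_def)
  have le: "(cmod (u x * f x))\<^sup>2 \<le> c\<^sup>2 * (cmod (f x))\<^sup>2" if "x \<in> space M" for x
    using c that by (auto simp: norm_mult power_mult_distrib intro!: mult_right_mono power_mono)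
  have i: "integrable M (\<lambda>x. (cmod (u x * f x))\<^sup>2)"
  proof (rule Bochner_Integration.integrable_bound)
    show "integrable M (\<lambda>x. c\<^sup>2 * (cmod (f x))\<^sup>2)"
      using fi by simp
  qed (use le in auto)
  then show "(\<lambda>x. u x * f x) \<in> L2_space M"
    by (simp add: L2_space_def)
  have "(LINT x|M. (cmod (u x * f x))\<^sup>2) \<le> (LINT x|M. c\<^sup>2 * (cmod (f x))\<^sup>2)"
    using i fi le by (intro integral_mono) auto
  then have "sqrt (LINT x|M. (cmod (u x * f x))\<^sup>2) \<le> sqrt (c\<^sup>2 * (LINT x|M. (cmod (f x))\<^sup>2))"
    by simp
  then show "L2_norm M (\<lambda>x. u x * f x) \<le> c * L2_norm M f"
    using c(1) by (simp add: L2_norm_def real_sqrt_mult)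
qed

lemma L2_inner_sum_left:
  assumes "\<And>i. i \<in> I \<Longrightarrow> f i \<in> L2_space M" "h \<in> L2_space M"
  shows "L2_inner M (\<lambda>x. \<Sum>i\<in>I. c i * f i x) h = (\<Sum>i\<in>I. c i * L2_inner M (f i) h)"
proof -
  have "L2_inner M (\<lambda>x. \<Sum>i\<in>I. c i * f i x) h = (LINT x|M. (\<Sum>i\<in>I. c i * (f i x * cnj (h x))))"
    by (simp add: L2_inner_def sum_distrib_right mult.assoc)
  also have "\<dots> = (\<Sum>i\<in>I. c i * L2_inner M (f i) h)"
    using assms by (subst Bochner_Integration.integral_sum)
      (auto simp: L2_inner_def intro!: integrable_L2_inner)
  finally show ?thesis .
qed

section \<open>Perturbation of a frame\<close>

lemma L2_set_cmod_sum_le: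
  assumes "finite I"
  shows "L2_set (\<lambda>k. cmod (\<Sum>i\<in>I. F i k)) S \<le> (\<Sum>i\<in>I. L2_set (\<lambda>k. cmod (F i k)) S)"
  using assms
proof (induction I rule: finite_induct)
  case empty
  then show ?case by (simp add: L2_set_def)
next
  case (insert j I)
  have "L2_set (\<lambda>k. cmod (\<Sum>i\<in>insert j I. F i k)) S
      \<le> L2_set (\<lambda>k. cmod (F j k) + cmod (\<Sum>i\<in>I. F i k)) S"
    using insert by (intro L2_set_mono) (auto intro: norm_triangle_ineq)
  also have "\<dots> \<le> L2_set (\<lambda>k. cmod (F j k)) S + L2_set (\<lambda>k. cmod (\<Sum>i\<in>I. F i k)) S"
    by (rule L2_set_triangle_ineq)
  finally show ?case using insert by simp
qed

lemma frame_ineq_imp_Bessel: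
  assumes "frame_ineq M h a (B\<^sup>2)" "g \<in> L2_space M" "0 \<le> B"
  shows "L2_set (\<lambda>k. cmod (L2_inner M g (h k))) {..<K} \<le> B * L2_norm M g"
proof -
  have "(\<Sum>k<K. (cmod (L2_inner M g (h k)))\<^sup>2) \<le> (\<Sum>k. (cmod (L2_inner M g (h k)))\<^sup>2)"
    using assms by (intro sum_le_suminf) (auto simp: frame_ineq_def)
  also have "\<dots> \<le> B\<^sup>2 * (L2_norm M g)\<^sup>2"
    using assms by (simp add: frame_ineq_def)
  finally have "(\<Sum>k<K. (cmod (L2_inner M g (h k)))\<^sup>2) \<le> (B * L2_norm M g)\<^sup>2"
    by (simp add: power_mult_distrib)
  then show ?thesis
    using assms(3) by (simp add: L2_set_def L2_norm_nonneg real_le_lsqrt sum_nonneg)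
qed

text \<open>
  The coefficient sequences of \<open>g\<close> with respect to \<open>h\<close> and \<open>f\<close> are at distance at most
  \<open>R \<parallel>g\<parallel>\<close> in \<open>\<ell>\<^sub>2\<close>, so the norm of the second lies between \<open>(A - R) \<parallel>g\<parallel>\<close> and
  \<open>(B + R) \<parallel>g\<parallel>\<close>; these are the new bounds.
\<close>

lemma frame_perturbation:
  assumes h: "frame_ineq M h (A\<^sup>2) (B\<^sup>2)" and f: "\<And>k. f k \<in> L2_space M"
    and AB: "0 < A" "A \<le> B" and R: "0 \<le> R" "R < A"
    and diff: "\<And>g K. g \<in> L2_space M \<Longrightarrow>
      L2_set (\<lambda>k. cmod (L2_inner M g (f k) - L2_inner M g (h k))) {..<K} \<le> R * L2_norm M g"
  shows "L2_frame M f"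
proof -
  have "frame_ineq M f ((A - R)\<^sup>2) ((B + R)\<^sup>2)"
    unfolding frame_ineq_def
  proof (intro ballI)
    fix g assume g: "g \<in> L2_space M"
    define a where "a k = cmod (L2_inner M g (h k))" for k
    define b where "b k = cmod (L2_inner M g (f k))" for k
    define e where "e k = cmod (L2_inner M g (f k) - L2_inner M g (h k))" for k
    define G where "G = L2_norm M g"
    have G: "0 \<le> G"
      by (simp add: G_def L2_norm_nonneg)
    have e: "L2_set e {..<K} \<le> R * G" for K
      using diff[OF g] by (simp add: e_def[abs_def] G_def)
    have "b k \<le> a k + e k" for k
      using norm_triangle_sub[of "L2_inner M g (f k)" "L2_inner M g (h k)"]
      by (simp add: a_def b_def e_def)
    then have "L2_set b {..<K} \<le> L2_set (\<lambda>k. a k + e k) {..<K}" for K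
      by (intro L2_set_mono) (auto simp: b_def)
    then have b_le: "L2_set b {..<K} \<le> L2_set a {..<K} + L2_set e {..<K}" for K
      using L2_set_triangle_ineq order_trans by blast
    have "a k \<le> b k + e k" for k
      using norm_triangle_sub[of "L2_inner M g (h k)" "L2_inner M g (f k)"]
      by (simp add: a_def b_def e_def norm_minus_commute)
    then have "L2_set a {..<K} \<le> L2_set (\<lambda>k. b k + e k) {..<K}" for K
      by (intro L2_set_mono) (auto simp: a_def)
    then have a_le: "L2_set a {..<K} \<le> L2_set b {..<K} + L2_set e {..<K}" for K
      using L2_set_triangle_ineq order_trans by blast
    have "L2_set a {..<K} \<le> B * G" for K
      using frame_ineq_imp_Bessel[OF h g] AB by (simp add: a_def[abs_def] G_def)
    then have b_bound: "L2_set b {..<K} \<le> (B + R) * G" for K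
      using b_le[of K] e[of K] by (smt (verit) distrib_right)
    have sq: "(\<Sum>k<K. (b k)\<^sup>2) = (L2_set b {..<K})\<^sup>2" for K
      by (simp add: L2_set_def sum_nonneg)
    have part: "(\<Sum>k<K. (b k)\<^sup>2) \<le> ((B + R) * G)\<^sup>2" for K
      unfolding sq using b_bound by (intro power_mono) (auto simp: L2_set_nonneg)
    have sm: "summable (\<lambda>k. (b k)\<^sup>2)"
      using part by (intro summableI_nonneg_bounded) auto
    have up: "(\<Sum>k. (b k)\<^sup>2) \<le> ((B + R) * G)\<^sup>2"
      using part sm by (intro suminf_le_const) auto
    have sma: "summable (\<lambda>k. (a k)\<^sup>2)" and lowa: "A\<^sup>2 * G\<^sup>2 \<le> (\<Sum>k. (a k)\<^sup>2)"
      using h g by (auto simp: frame_ineq_def a_def G_def)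
    have lim: "(\<lambda>K. L2_set s {..<K}) \<longlonglongrightarrow> sqrt (\<Sum>k. (s k)\<^sup>2)"
      if "summable (\<lambda>k. (s k)\<^sup>2)" for s :: "nat \<Rightarrow> real"
      unfolding L2_set_def using that by (intro tendsto_real_sqrt summable_LIMSEQ)
    have "L2_set a {..<K} \<le> L2_set b {..<K} + R * G" for K
      using a_le[of K] e[of K] by linarith
    then have "sqrt (\<Sum>k. (a k)\<^sup>2) \<le> sqrt (\<Sum>k. (b k)\<^sup>2) + R * G"
      by (intro LIMSEQ_le[OF lim[OF sma] tendsto_add[OF lim[OF sm] tendsto_const]]) auto
    moreover have "A * G \<le> sqrt (\<Sum>k. (a k)\<^sup>2)"
      using lowa by (intro real_le_rsqrt) (simp add: power_mult_distrib)
    ultimately have "(A - R) * G \<le> sqrt (\<Sum>k. (b k)\<^sup>2)"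
      by (simp add: left_diff_distrib)
    then have "((A - R) * G)\<^sup>2 \<le> (sqrt (\<Sum>k. (b k)\<^sup>2))\<^sup>2"
      using R G by (intro power_mono) auto
    also have "\<dots> = (\<Sum>k. (b k)\<^sup>2)"
      using sm by (simp add: suminf_nonneg)
    finally have low: "((A - R) * G)\<^sup>2 \<le> (\<Sum>k. (b k)\<^sup>2)" .
    show "summable (\<lambda>k. (cmod (L2_inner M g (f k)))\<^sup>2) \<and>
        (A - R)\<^sup>2 * (L2_norm M g)\<^sup>2 \<le> (\<Sum>k. (cmod (L2_inner M g (f k)))\<^sup>2) \<and>
        (\<Sum>k. (cmod (L2_inner M g (f k)))\<^sup>2) \<le> (B + R)\<^sup>2 * (L2_norm M g)\<^sup>2"
      using sm low up by (simp add: b_def G_def power_mult_distrib)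
  qed
  moreover have "0 < A - R" "A - R \<le> B + R"
    using AB R by auto
  ultimately show ?thesis
    using f unfolding L2_frame_def by blast
qed

section \<open>Multipliers that depend on the index\<close>

text \<open>
  The multiplier \<open>p\<^sub>k = \<Sum>i. a\<^sub>k\<^sub>i u\<^sub>i\<close> splits \<open>\<langle>p\<^sub>k\<^sup>n\<^sup>+\<^sup>1 g, h\<^sub>k\<rangle>\<close> into the sum of the
  \<open>a\<^sub>k\<^sub>i \<langle>p\<^sub>k\<^sup>n (u\<^sub>i g), h\<^sub>k\<rangle>\<close>. Since \<open>u\<^sub>i g\<close> no longer depends on \<open>k\<close>, the induction hypothesis for \<open>n\<close>
  applies to it, and each of the \<open>card I\<close> summands costs a factor \<open>\<delta> c\<close>. This is why the
  induction has to run over all \<open>g\<close> at once.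
\<close>

lemma Bessel_power_multiplier:
  fixes a :: "nat \<Rightarrow> 'i \<Rightarrow> complex" and u :: "'i \<Rightarrow> 'a \<Rightarrow> complex"
  assumes Bessel: "\<And>g. g \<in> L2_space M \<Longrightarrow>
      L2_set (\<lambda>k. cmod (L2_inner M g (h k))) S \<le> B * L2_norm M g"
    and h: "\<And>k. h k \<in> L2_space M"
    and I: "finite I" and a: "\<And>k i. i \<in> I \<Longrightarrow> cmod (a k i) \<le> \<delta>"
    and um: "\<And>i. i \<in> I \<Longrightarrow> u i \<in> borel_measurable M"
    and uc: "\<And>i x. i \<in> I \<Longrightarrow> x \<in> space M \<Longrightarrow> cmod (u i x) \<le> c"
    and nonneg: "0 \<le> B" "0 \<le> \<delta>" "0 \<le> c"
    and g: "g \<in> L2_space M"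
  shows "L2_set (\<lambda>k. cmod (L2_inner M (\<lambda>x. (\<Sum>i\<in>I. a k i * u i x) ^ n * g x) (h k))) S
    \<le> (real (card I) * \<delta> * c) ^ n * (B * L2_norm M g)"
  using g
proof (induction n arbitrary: g)
  case 0
  then show ?case using Bessel by simp
next
  case (Suc n)
  define p where "p k x = (\<Sum>i\<in>I. a k i * u i x)" for k x
  define C where "C = real (card I) * \<delta> * c"
  have C: "0 \<le> C"
    using nonneg by (simp add: C_def)
  have pm: "(\<lambda>x. p k x ^ n) \<in> borel_measurable M" for k
    unfolding p_def using um by measurable
  have "cmod (p k x) \<le> (\<Sum>i\<in>I. \<delta> * c)" if "x \<in> space M" for k x
    unfolding p_def using a uc nonneg that
    by (intro sum_norm_le) (auto simp: norm_mult intro!: mult_mono)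
  then have pc: "cmod (p k x ^ n) \<le> C ^ n" if "x \<in> space M" for k x
    unfolding norm_power using that by (intro power_mono) (auto simp: C_def mult.assoc)
  have ug: "(\<lambda>x. u i x * g x) \<in> L2_space M"
    "L2_norm M (\<lambda>x. u i x * g x) \<le> c * L2_norm M g" if "i \<in> I" for i
    using L2_bounded_multiplier[OF Suc.prems um nonneg(3) uc] that by auto
  define F where "F i k = L2_inner M (\<lambda>x. p k x ^ n * (u i x * g x)) (h k)" for i k
  have split: "L2_inner M (\<lambda>x. p k x ^ Suc n * g x) (h k) = (\<Sum>i\<in>I. a k i * F i k)" for k
  proof -
    have "p k x ^ Suc n * g x = (\<Sum>i\<in>I. a k i * (p k x ^ n * (u i x * g x)))" for x
    proof -
      have "p k x ^ Suc n * g x = (\<Sum>i\<in>I. a k i * u i x) * (p k x ^ n * g x)"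
        by (simp add: p_def)
      also have "\<dots> = (\<Sum>i\<in>I. a k i * (p k x ^ n * (u i x * g x)))"
        unfolding sum_distrib_right by (intro sum.cong) (auto simp: mult_ac)
      finally show ?thesis .
    qed
    moreover have "(\<lambda>x. p k x ^ n * (u i x * g x)) \<in> L2_space M" if "i \<in> I" for i
      using C by (intro L2_bounded_multiplier(1)[OF ug(1)[OF that] pm _ pc]) auto
    ultimately show ?thesis
      unfolding F_def using h by (simp only: L2_inner_sum_left)
  qed
  have "L2_set (\<lambda>k. cmod (\<Sum>i\<in>I. a k i * F i k)) S
      \<le> (\<Sum>i\<in>I. L2_set (\<lambda>k. cmod (a k i * F i k)) S)"
    by (rule L2_set_cmod_sum_le[OF I])
  also have "\<dots> \<le> (\<Sum>i\<in>I. \<delta> * (C ^ n * (B * (c * L2_norm M g))))"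
  proof (rule sum_mono)
    fix i assume i: "i \<in> I"
    have "L2_set (\<lambda>k. cmod (a k i * F i k)) S \<le> L2_set (\<lambda>k. \<delta> * cmod (F i k)) S"
      using a[OF i] by (intro L2_set_mono) (auto simp: norm_mult intro: mult_right_mono)
    also have "\<dots> = \<delta> * L2_set (\<lambda>k. cmod (F i k)) S"
      using nonneg by (simp add: L2_set_right_distrib)
    also have "\<dots> \<le> \<delta> * (C ^ n * (B * L2_norm M (\<lambda>x. u i x * g x)))"
      using Suc.IH[OF ug(1)[OF i]] nonneg
      by (intro mult_left_mono) (auto simp: F_def p_def C_def)
    also have "\<dots> \<le> \<delta> * (C ^ n * (B * (c * L2_norm M g)))"
      using ug(2)[OF i] nonneg C by (intro mult_left_mono) auto
    finally show "L2_set (\<lambda>k. cmod (a k i * F i k)) S \<le> \<delta> * (C ^ n * (B * (c * L2_norm M g)))" .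
  qed
  also have "\<dots> = C ^ Suc n * (B * L2_norm M g)"
    by (simp add: C_def)
  finally show ?case
    by (simp only: split[unfolded p_def] C_def)
qed

text \<open>
  The power series of \<open>exp (p\<^sub>k)\<close> may be integrated term by term, because its partial sums are
  dominated by the constant \<open>e\<^sup>C\<close>, where \<open>C = card I \<cdot> \<delta> \<cdot> c\<close>. Its term of order zero is cancelled
  by \<open>\<langle>g, h\<^sub>k\<rangle>\<close>, which leaves the series \<open>\<Sum>n\<ge>1. C\<^sup>n / n! = e\<^sup>C - 1\<close> as the bound.
\<close>

lemma Bessel_exp_multiplier:
  fixes a :: "nat \<Rightarrow> 'i \<Rightarrow> complex" and u :: "'i \<Rightarrow> 'a \<Rightarrow> complex"
  assumes Bessel: "\<And>g. g \<in> L2_space M \<Longrightarrow>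
      L2_set (\<lambda>k. cmod (L2_inner M g (h k))) S \<le> B * L2_norm M g"
    and h: "\<And>k. h k \<in> L2_space M"
    and I: "finite I" and a: "\<And>k i. i \<in> I \<Longrightarrow> cmod (a k i) \<le> \<delta>"
    and um: "\<And>i. i \<in> I \<Longrightarrow> u i \<in> borel_measurable M"
    and uc: "\<And>i x. i \<in> I \<Longrightarrow> x \<in> space M \<Longrightarrow> cmod (u i x) \<le> c"
    and nonneg: "0 \<le> B" "0 \<le> \<delta>" "0 \<le> c"
    and g: "g \<in> L2_space M"
  shows "L2_set (\<lambda>k. cmod (L2_inner M (\<lambda>x. exp (\<Sum>i\<in>I. a k i * u i x) * g x) (h k)
      - L2_inner M g (h k))) S \<le> (exp (real (card I) * \<delta> * c) - 1) * (B * L2_norm M g)"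
proof -
  define p where "p k x = (\<Sum>i\<in>I. a k i * u i x)" for k x
  define C where "C = real (card I) * \<delta> * c"
  define G where "G = B * L2_norm M g"
  have G: "0 \<le> G"
    using nonneg by (simp add: G_def L2_norm_nonneg)
  have C: "0 \<le> C"
    using nonneg by (simp add: C_def)
  have pm [measurable]: "p k \<in> borel_measurable M" for k
    unfolding p_def using um by measurable
  have "cmod (p k x) \<le> (\<Sum>i\<in>I. \<delta> * c)" if "x \<in> space M" for k x
    unfolding p_def using a uc nonneg that
    by (intro sum_norm_le) (auto simp: norm_mult intro!: mult_mono)
  then have pc: "cmod (p k x) \<le> C" if "x \<in> space M" for k x
    using that by (simp add: C_def mult.assoc)
  have pg: "(\<lambda>x. p k x ^ n * g x) \<in> L2_space M" for k n
  proof (rule L2_bounded_multiplier(1)[OF g])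
    show "cmod (p k x ^ n) \<le> C ^ n" if "x \<in> space M" for x
      unfolding norm_power using pc[OF that] by (intro power_mono) auto
  qed (use C in auto)
  define E where "E n k = (1 / fact n) * L2_inner M (\<lambda>x. p k x ^ n * g x) (h k)" for n k
  have E0: "E 0 k = L2_inner M g (h k)" for k
    by (simp add: E_def)
  have E_bound: "L2_set (\<lambda>k. cmod (E n k)) S \<le> C ^ n / fact n * G" for n
  proof -
    have "L2_set (\<lambda>k. cmod (E n k)) S
        = L2_set (\<lambda>k. (1 / fact n) * cmod (L2_inner M (\<lambda>x. p k x ^ n * g x) (h k))) S"
      by (simp add: E_def norm_mult norm_divide)
    also have "\<dots> = (1 / fact n) * L2_set (\<lambda>k. cmod (L2_inner M (\<lambda>x. p k x ^ n * g x) (h k))) S"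
      by (rule L2_set_right_distrib[symmetric]) simp
    also have "\<dots> \<le> (1 / fact n) * (C ^ n * G)"
      unfolding p_def C_def G_def
      by (intro mult_left_mono Bessel_power_multiplier[OF Bessel h I a um uc nonneg g]) auto
    finally show ?thesis by simp
  qed
  have exp_sums: "(\<lambda>n. C ^ n / fact n) sums exp C"
    using exp_converges[of C] by (simp add: divide_inverse mult.commute)
  have exp_part: "(\<Sum>n<N. C ^ n / fact n) \<le> exp C" for N
    using exp_sums C by (intro sum_le_suminf[THEN order_trans]) (auto simp: sums_iff)
  have conv: "(\<lambda>N. \<Sum>n<N. E n k) \<longlonglongrightarrow> L2_inner M (\<lambda>x. exp (p k x) * g x) (h k)" for k
  proof -
    have [measurable]: "g \<in> borel_measurable M" "h k \<in> borel_measurable M"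
      using g h by (auto simp: L2_space_def)
    have [measurable]: "cnj \<in> borel_measurable borel" "(exp :: complex \<Rightarrow> complex) \<in> borel_measurable borel"
      by (intro borel_measurable_continuous_onI continuous_intros)+
    have "(\<lambda>N. LINT x|M. (\<Sum>n<N. (1 / fact n) * (p k x ^ n * g x)) * cnj (h k x))
        \<longlonglongrightarrow> (LINT x|M. exp (p k x) * g x * cnj (h k x))"
    proof (rule integral_dominated_convergence)
      show "integrable M (\<lambda>x. exp C * cmod (g x * cnj (h k x)))"
        using integrable_L2_inner[OF g h] by (intro integrable_mult_right integrable_norm)
      show "AE x in M. (\<lambda>N. (\<Sum>n<N. (1 / fact n) * (p k x ^ n * g x)) * cnj (h k x))
          \<longlonglongrightarrow> exp (p k x) * g x * cnj (h k x)"
      proof (intro AE_I2 tendsto_mult tendsto_const)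
        fix x
        have "(\<lambda>n. (p k x ^ n /\<^sub>R fact n) * g x) sums (exp (p k x) * g x)"
          by (intro sums_mult2 exp_converges)
        then show "(\<lambda>N. \<Sum>n<N. (1 / fact n) * (p k x ^ n * g x)) \<longlonglongrightarrow> exp (p k x) * g x"
          by (simp add: sums_def scaleR_conv_of_real field_simps)
      qed
      show "AE x in M. norm ((\<Sum>n<N. (1 / fact n) * (p k x ^ n * g x)) * cnj (h k x))
          \<le> exp C * cmod (g x * cnj (h k x))" for N
      proof (rule AE_I2)
        fix x assume x: "x \<in> space M"
        have "cmod (\<Sum>n<N. (1 / fact n) * p k x ^ n) \<le> (\<Sum>n<N. C ^ n / fact n)"
          using pc[OF x] by (intro sum_norm_le)
            (auto simp: norm_divide norm_power intro!: divide_right_mono power_mono)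
        also have "\<dots> \<le> exp C"
          by (rule exp_part)
        finally have "cmod (\<Sum>n<N. (1 / fact n) * p k x ^ n) * cmod (g x * cnj (h k x))
            \<le> exp C * cmod (g x * cnj (h k x))"
          by (rule mult_right_mono) simp
        moreover have "(\<Sum>n<N. (1 / fact n) * (p k x ^ n * g x)) * cnj (h k x)
            = (\<Sum>n<N. (1 / fact n) * p k x ^ n) * (g x * cnj (h k x))"
          by (simp add: sum_distrib_right mult.assoc)
        ultimately show "norm ((\<Sum>n<N. (1 / fact n) * (p k x ^ n * g x)) * cnj (h k x))
            \<le> exp C * cmod (g x * cnj (h k x))"
          by (simp only: norm_mult)
      qed
    qed measurable
    moreover have "(LINT x|M. (\<Sum>n<N. (1 / fact n) * (p k x ^ n * g x)) * cnj (h k x))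
        = (\<Sum>n<N. E n k)" for N
      unfolding E_def by (subst L2_inner_sum_left[OF pg h, symmetric]) (simp add: L2_inner_def)
    ultimately show ?thesis
      by (simp add: L2_inner_def)
  qed
  have part: "L2_set (\<lambda>k. cmod (\<Sum>n<N. E (Suc n) k)) S \<le> (exp C - 1) * G" for N
  proof -
    have "L2_set (\<lambda>k. cmod (\<Sum>n<N. E (Suc n) k)) S \<le> (\<Sum>n<N. L2_set (\<lambda>k. cmod (E (Suc n) k)) S)"
      by (rule L2_set_cmod_sum_le) simp
    also have "\<dots> \<le> (\<Sum>n<N. C ^ Suc n / fact (Suc n) * G)"
      by (intro sum_mono E_bound)
    also have "\<dots> = (\<Sum>n<N. C ^ Suc n / fact (Suc n)) * G"
      by (rule sum_distrib_right[symmetric])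
    also have "(\<Sum>n<N. C ^ Suc n / fact (Suc n)) = (\<Sum>n<Suc N. C ^ n / fact n) - 1"
      by (subst sum.lessThan_Suc_shift) simp
    also have "((\<Sum>n<Suc N. C ^ n / fact n) - 1) * G \<le> (exp C - 1) * G"
      using exp_part[of "Suc N"] G by (intro mult_right_mono) auto
    finally show ?thesis .
  qed
  have "(\<lambda>N. \<Sum>n<N. E (Suc n) k)
      \<longlonglongrightarrow> L2_inner M (\<lambda>x. exp (p k x) * g x) (h k) - L2_inner M g (h k)" for k
  proof -
    have "(\<lambda>N. (\<Sum>n<Suc N. E n k) - E 0 k)
        \<longlonglongrightarrow> L2_inner M (\<lambda>x. exp (p k x) * g x) (h k) - L2_inner M g (h k)"
      using LIMSEQ_Suc[OF conv[of k]] by (auto simp only: E0 intro!: tendsto_diff tendsto_const)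
    then show ?thesis
      by (simp only: sum.lessThan_Suc_shift add_diff_cancel_left')
  qed
  then have "(\<lambda>N. L2_set (\<lambda>k. cmod (\<Sum>n<N. E (Suc n) k)) S) \<longlonglongrightarrow>
      L2_set (\<lambda>k. cmod (L2_inner M (\<lambda>x. exp (p k x) * g x) (h k) - L2_inner M g (h k))) S"
    unfolding L2_set_def
    by (intro tendsto_real_sqrt tendsto_sum tendsto_power tendsto_norm)
  then have "L2_set (\<lambda>k. cmod (L2_inner M (\<lambda>x. exp (p k x) * g x) (h k) - L2_inner M g (h k))) S
      \<le> (exp C - 1) * G"
    by (rule LIMSEQ_le_const2) (use part in auto)
  then show ?thesis
    by (simp add: p_def C_def G_def)
qed

section \<open>Exponentials on the cube\<close>

lemma space_cube_measure: "space cube_measure = cbox (\<chi> i. - pi) (\<chi> i. pi)"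
  by (simp add: cube_measure_def)

lemma continuous_imp_measurable_cube:
  "continuous_on UNIV f \<Longrightarrow> f \<in> borel_measurable cube_measure"
  unfolding cube_measure_def
  by (rule continuous_imp_measurable_on_sets_lebesgue) (auto intro: continuous_on_subset)

lemma expo_in_L2_space:
  fixes t :: "real ^ 'd"
  shows "expo t \<in> L2_space cube_measure"
proof -
  interpret finite_measure "cube_measure :: (real ^ 'd) measure"
    unfolding cube_measure_def by (rule finite_measure_lebesgue_on) simp
  have "continuous_on UNIV (expo t)"
    unfolding expo_def[abs_def] by (intro continuous_intros)
  moreover have "cmod (expo t x) = cmod (1 / complex_of_real ((2 * pi) powr (real CARD('d) / 2)))"
    for x
    by (simp add: expo_def norm_mult norm_divide norm_exp_i_times)
  ultimately show ?thesis
    by (simp add: L2_space_def continuous_imp_measurable_cube)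
qed

lemma cnj_expo_shift:
  "cnj (expo \<tau> x) = exp (\<Sum>i\<in>UNIV. - \<i> * complex_of_real ((\<tau> - t) $ i) * complex_of_real (x $ i))
     * cnj (expo t x)"
proof -
  have "(\<Sum>i\<in>UNIV. - \<i> * complex_of_real ((\<tau> - t) $ i) * complex_of_real (x $ i))
      = - \<i> * complex_of_real (x \<bullet> (\<tau> - t))"
    by (simp add: inner_vec_def sum_distrib_left mult_ac sum_negf)
  moreover have "cnj (exp (\<i> * complex_of_real r)) = exp (- \<i> * complex_of_real r)" for r
    by (simp add: exp_cnj)
  moreover have "exp (- \<i> * complex_of_real (x \<bullet> \<tau>))
      = exp (- \<i> * complex_of_real (x \<bullet> (\<tau> - t))) * exp (- \<i> * complex_of_real (x \<bullet> t))"
    unfolding exp_add[symmetric] by (simp add: inner_diff_right right_diff_distrib)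
  ultimately show ?thesis
    unfolding expo_def complex_cnj_mult by (simp only: mult_ac)
qed

theorem theorem2:
  fixes t \<tau> :: "nat \<Rightarrow> real ^ 'd" and A B :: real
  assumes "0 < A" and "A \<le> B"
    and "L2_frame cube_measure (\<lambda>k. expo (t k))"
    and "L2_frame_bounds cube_measure (\<lambda>k. expo (t k)) (A\<^sup>2) (B\<^sup>2)"
    and "(SUP k. ereal (infnorm (\<tau> k - t k)))
           < ereal (1 / (pi * real CARD('d)) * ln (1 + A / B))"
  shows "L2_frame cube_measure (\<lambda>k. expo (\<tau> k))"
proof -
  let ?d = "real CARD('d)"
  have B: "0 < B"
    using assms(1,2) by simp
  \<comment> \<open>A real number above the supremum, which is only an extended real, bounds all perturbations at once.\<close>
  obtain \<delta> where \<delta>: "(SUP k. ereal (infnorm (\<tau> k - t k))) < ereal \<delta>"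
      "ereal \<delta> < ereal (1 / (pi * ?d) * ln (1 + A / B))"
    using ereal_dense2[OF assms(5)] by blast
  have inf: "infnorm (\<tau> k - t k) \<le> \<delta>" for k
  proof -
    have "ereal (infnorm (\<tau> k - t k)) \<le> (SUP k. ereal (infnorm (\<tau> k - t k)))"
      by (rule SUP_upper) simp
    also have "\<dots> < ereal \<delta>"
      by (rule \<delta>(1))
    finally show ?thesis by simp
  qed
  then have \<delta>0: "0 \<le> \<delta>"
    using infnorm_pos_le order_trans by blast
  have coord: "\<bar>(\<tau> k - t k) $ i\<bar> \<le> \<delta>" for k i
    using inf[of k] component_le_infnorm_cart[of "\<tau> k - t k" i] by linarith
  define R where "R = (exp (?d * \<delta> * pi) - 1) * B"
  have "?d * \<delta> * pi < ln (1 + A / B)"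
    using \<delta>(2) by (simp add: field_simps)
  then have "exp (?d * \<delta> * pi) < exp (ln (1 + A / B))"
    by simp
  also have "\<dots> = 1 + A / B"
    using assms(1) B by (intro exp_ln add_pos_pos divide_pos_pos) auto
  finally have "exp (?d * \<delta> * pi) < 1 + A / B" .
  then have R: "R < A" "0 \<le> R"
    using B \<delta>0 by (auto simp: R_def field_simps)
  have fr: "frame_ineq cube_measure (\<lambda>k. expo (t k)) (A\<^sup>2) (B\<^sup>2)"
    using assms(4) by (simp add: L2_frame_bounds_def)
  show ?thesis
  proof (rule frame_perturbation[OF fr expo_in_L2_space assms(1,2) R(2,1)])
    fix g :: "real ^ 'd \<Rightarrow> complex" and K :: nat
    assume g: "g \<in> L2_space cube_measure"
    let ?p = "\<lambda>k x. \<Sum>i\<in>UNIV. - \<i> * complex_of_real ((\<tau> k - t k) $ i) * complex_of_real (x $ i)"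
    have shift: "L2_inner cube_measure g (expo (\<tau> k))
        = L2_inner cube_measure (\<lambda>x. exp (?p k x) * g x) (expo (t k))" for k
      unfolding L2_inner_def cnj_expo_shift[of "\<tau> k" _ "t k"] by (simp only: mult_ac)
    have "L2_set (\<lambda>k. cmod (L2_inner cube_measure (\<lambda>x. exp (?p k x) * g x) (expo (t k))
          - L2_inner cube_measure g (expo (t k)))) {..<K}
        \<le> (exp (?d * \<delta> * pi) - 1) * (B * L2_norm cube_measure g)"
    proof (rule Bessel_exp_multiplier[where I = UNIV and \<delta> = \<delta> and c = pi])
      show "(\<lambda>x. complex_of_real (x $ i)) \<in> borel_measurable cube_measure" for i :: 'd
        by (intro continuous_imp_measurable_cube continuous_intros)
      show "cmod (complex_of_real (x $ i)) \<le> pi" if "x \<in> space cube_measure"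
        for i :: 'd and x
        using that by (auto simp: space_cube_measure mem_box_cart abs_le_iff minus_le_iff)
      show "cmod (- \<i> * complex_of_real ((\<tau> k - t k) $ i)) \<le> \<delta>" for k i
        using coord[of k i] by (simp add: norm_mult del: vector_minus_component)
    qed (use frame_ineq_imp_Bessel[OF fr] expo_in_L2_space g B \<delta>0 in auto)
    then show "L2_set (\<lambda>k. cmod (L2_inner cube_measure g (expo (\<tau> k))
          - L2_inner cube_measure g (expo (t k)))) {..<K} \<le> R * L2_norm cube_measure g"
      by (simp only: shift R_def mult.assoc)
  qed
qed

end
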